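(* Let $b\ge 2$ be an integer, let $n\ge 1$, and let $D=\{d_0,\dots,d_{n-1}\}$ be a set of integers with $0=d_0<d_1<\dots<d_{n-1}$. Let $\mathbb{Z}_b[D]$ be the set of integers of the form $\sum_{i=0}^{n-1}a_ib^{d_i}$ with all $a_i\in\{0,1,\dots,b-1\}$. Then for \[ m=\left\lceil \log_b\big((2b-1)^n-1\big)\right\rceil \] there exist a non-negative integer $\mu$ and a non-negative integer $k$ such that the map $\mathbb{Z}_b[D]\to\{0,1,\dots,b-1\}^m$, $a\mapsto \mathrm{dig}(a\mu)_{k,m}$, is injective. Furthermore, if $D$ is the union of pairwise disjoint integer intervals $\{c_i,c_i+1,\dots,c_i+\ell_i-1\}$ for $i=1,\dots,r$ with all $\ell_i\ge 1$, then the same conclusion holds with \[ m=\left\lceil \log_b\Big(\prod_{i=1}^{r}(2b^{\ell_i}-1)-1\Big)\right\rceil. \]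
   Context: For a non-negative integer $x=\sum_{i\ge 0}x_ib^i$ written in base $b$ (digits $x_i\in\{0,\dots,b-1\}$, all but finitely many zero), and integers $k\ge 0$, $m\ge 1$, $\mathrm{dig}(x)_{k,m}$ denotes the $m$-tuple of base-$b$ digits $(x_{k+m-1},\dots,x_{k+1},x_k)\in\{0,1,\dots,b-1\}^m$. *)

theory Defs
  imports Complex_Main "HOL-Library.Disjoint_Sets" "HOL-Library.FuncSet"
begin

definition digit :: "nat \<Rightarrow> nat \<Rightarrow> nat \<Rightarrow> nat" where
  "digit b x i = x div b ^ i mod b"

(* The m-tuple (x_{k+m-1}, ..., x_{k+1}, x_k), most significant digit first. *)
definition dig :: "nat \<Rightarrow> nat \<Rightarrow> nat \<Rightarrow> nat \<Rightarrow> nat list" where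
  "dig b x k m = map (digit b x) (rev [k..<k + m])"

definition digit_tuples :: "nat \<Rightarrow> nat \<Rightarrow> nat list set" where
  "digit_tuples b m = {xs. length xs = m \<and> set xs \<subseteq> {0..<b}}"

(* The set Z_b[D], where D = {d 0, ..., d (n - 1)}. *)
definition ZD :: "nat \<Rightarrow> nat \<Rightarrow> (nat \<Rightarrow> nat) \<Rightarrow> nat set" where
  "ZD b n d = {(\<Sum>i<n. a i * b ^ d i) | a. \<forall>i<n. a i \<in> {0..<b}}"

lemma digit_less: "b \<ge> 2 \<Longrightarrow> digit b x i < b"
  by (simp add: digit_def)

lemma digit_expansion: "x < b ^ N \<Longrightarrow> x = (\<Sum>i<N. digit b x i * b ^ i)"
proof -
  have "x mod b ^ N = (\<Sum>i<N. digit b x i * b ^ i)"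
  proof (induction N)
    case (Suc N)
    have "x mod b ^ Suc N = b ^ N * (x div b ^ N mod b) + x mod b ^ N"
      by (simp only: power_Suc2 mod_mult2_eq)
    then show ?case
      using Suc by (simp add: digit_def)
  qed simp
  then show "x < b ^ N \<Longrightarrow> x = (\<Sum>i<N. digit b x i * b ^ i)"
    by simp
qed

end

theory Submission
  imports Defs
begin

text \<open>
  Two elements of the set \<open>ZD b n d\<close> with difference \<open>s > 0\<close> get different digit windows as soon
  as \<open>s * \<mu>\<close> has distance at least \<open>b ^ k\<close> to every multiple of \<open>b ^ (k + m)\<close>. If \<open>k\<close> is so large
  that \<open>gcd s (b ^ (k + m))\<close> divides \<open>b ^ k\<close>, this fails for at most \<open>2 * b ^ k - 1\<close> residues \<open>\<mu>\<close>
  modulo \<open>b ^ (k + m)\<close>. The differences lie in a set of \<open>P = (\<Prod>i. 2 * b ^ l i - 1)\<close> integers that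
  is symmetric about \<open>0\<close>, so at most \<open>(P - 1) / 2\<close> of them are positive, and because
  \<open>P - 1 \<le> b ^ m\<close> the excluded residues cannot exhaust all \<open>b ^ (k + m)\<close> of them.
\<close>

section \<open>Choosing a multiplier by counting excluded residues\<close>

text \<open>Unless \<open>g = 1\<close>, the factor \<open>gcd g b\<close> is at least 2; splitting
  it off at least halves \<open>g\<close> and costs one power of \<open>b\<close>, so
  \<open>g\<close> powers suffice. The resulting exponent does not involve \<open>K\<close>, which
  later lets \<open>k\<close> depend only on the differences \<open>s\<close>.\<close>

lemma dvd_power_imp_dvd_power_self:
  fixes g b K :: nat
  assumes "g dvd b ^ K" and "b > 0"
  shows "g dvd b ^ g"
  using assms(1)
proof (induction g rule: less_induct)
  case (less g)
  have "g > 0"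
    using less.prems \<open>b > 0\<close> by (intro Nat.gr0I) auto
  show ?case
  proof (cases "g = 1")
    case False
    define h where "h = gcd g b"
    have "h \<noteq> 1"
    proof
      assume "h = 1"
      then have "coprime g (b ^ K)"
        unfolding h_def by (intro coprime_power_right_iff[THEN iffD2]) (simp add: coprime_iff_gcd_eq_1)
      with less.prems have "g dvd 1"
        by (metis coprime_common_divisor dvd_refl)
      with False show False by simp
    qed
    moreover have "h > 0"
      using \<open>g > 0\<close> by (simp add: h_def)
    ultimately have "h \<ge> 2" by simp
    obtain g' where g': "g = h * g'"
      using h_def by (metis dvdE gcd_dvd1)
    have "g' > 0" using \<open>g > 0\<close> g' by simp
    have "2 * g' \<le> g"
      using \<open>h \<ge> 2\<close> by (simp add: g')
    with \<open>g' > 0\<close> have "g' < g" "Suc g' \<le> g" by linarith+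
    have "g' dvd b ^ K"
      using less.prems g' by (metis dvd_mult_right)
    then have "g' dvd b ^ g'"
      using less.IH \<open>g' < g\<close> by blast
    \<comment> \<open>One factor \<open>b\<close> absorbs \<open>h\<close>, the remaining
      \<open>b ^ g'\<close> absorbs \<open>g'\<close>.\<close>
    then have "h * g' dvd b * b ^ g'"
      by (intro mult_dvd_mono) (simp_all add: h_def)
    also have "\<dots> dvd b ^ g"
      using \<open>Suc g' \<le> g\<close> by (metis le_imp_power_dvd power_Suc)
    finally show ?thesis by (simp only: g')
  qed simp
qed

text \<open>After division by \<open>gcd s Q\<close> the coefficient is coprime to the reduced
  modulus \<open>q\<close>, so all solutions agree modulo \<open>q\<close>. Below
  \<open>Q = q * g\<close> a residue class modulo \<open>q\<close> has \<open>g\<close> members,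
  told apart by their quotients \<open>\<mu> div q\<close>.\<close>

lemma card_linear_congruence_solutions_le:
  fixes s Q :: nat and x :: int
  assumes "Q > 0"
  shows "card {\<mu>. \<mu> < Q \<and> (\<exists>t. int s * int \<mu> - t * int Q = x)} \<le> gcd s Q"
    (is "card ?F \<le> _")
proof -
  define g where "g = gcd s Q"
  have "g > 0" using assms by (simp add: g_def)
  obtain s' q where s': "s = s' * g" and q: "Q = q * g" and cop: "coprime s' q"
    using gcd_coprime_exists[of s Q] \<open>g > 0\<close> unfolding g_def by auto
  have "q > 0" using assms q by (cases q) auto
  have "inj_on (\<lambda>\<mu>. \<mu> div q) ?F"
  proof (rule inj_onI)
    fix \<mu> \<nu> assume "\<mu> \<in> ?F" "\<nu> \<in> ?F" and eq: "\<mu> div q = \<nu> div q"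
    then obtain t u where "int s * int \<mu> - t * int Q = x" "int s * int \<nu> - u * int Q = x"
      by blast
    then have "int s * (int \<mu> - int \<nu>) = (t - u) * int Q"
      by (simp add: algebra_simps)
    then have "int g * (int s' * (int \<mu> - int \<nu>)) = int g * (int q * (t - u))"
      by (simp add: s' q algebra_simps)
    then have "int s' * (int \<mu> - int \<nu>) = int q * (t - u)"
      using \<open>g > 0\<close> by simp
    then have "int q dvd int s' * (int \<mu> - int \<nu>)"
      by (metis dvd_triv_left)
    moreover have "coprime (int q) (int s')"
      using cop by (simp add: coprime_commute)
    ultimately have "int q dvd int \<mu> - int \<nu>"
      by (simp add: coprime_dvd_mult_right_iff)
    then have "\<mu> mod q = \<nu> mod q"
      by (metis mod_eq_dvd_iff of_nat_eq_iff of_nat_mod)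
    with eq show "\<mu> = \<nu>"
      by (metis div_mult_mod_eq)
  qed
  moreover have "(\<lambda>\<mu>. \<mu> div q) ` ?F \<subseteq> {..<g}"
    using \<open>q > 0\<close> by (auto simp: q div_less_iff_less_mult mult.commute)
  ultimately have "card ?F \<le> card {..<g}"
    by (intro card_inj_on_le) auto
  then show ?thesis by (simp add: g_def)
qed

text \<open>With \<open>g = gcd s Q\<close> and \<open>B = g * h\<close>, every offset is a multiple
  of \<open>g\<close>, and only \<open>2 * h - 1\<close> such multiples have absolute value below
  \<open>B\<close>. Each is attained by at most \<open>g\<close> residues, which gives at most
  \<open>2 * B - g\<close>. The strict bound allows equality in
  \<open>2 * card S \<le> b ^ m\<close> later.\<close>

lemma card_multiples_near_lattice_less:
  fixes s Q B :: nat
  assumes "Q > 0" and "B > 0" and "gcd s Q dvd B"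
  shows "card {\<mu>. \<mu> < Q \<and> (\<exists>t. \<bar>int s * int \<mu> - t * int Q\<bar> < int B)} < 2 * B"
    (is "card ?A < _")
proof -
  define g where "g = gcd s Q"
  have "g > 0" using assms by (simp add: g_def)
  obtain h where h: "B = g * h"
    using assms(3) by (auto simp: g_def)
  have "h > 0" using assms(2) h by simp
  define F where "F j = {\<mu>. \<mu> < Q \<and> (\<exists>t. int s * int \<mu> - t * int Q = int g * j)}" for j
  have "?A \<subseteq> (\<Union>j\<in>{- int h<..<int h}. F j)"
  proof
    fix \<mu> assume "\<mu> \<in> ?A"
    then obtain t where "\<mu> < Q" and t: "\<bar>int s * int \<mu> - t * int Q\<bar> < int B" by blast
    have "int g dvd int s * int \<mu> - t * int Q"
      by (intro dvd_diff dvd_mult dvd_mult2) (simp_all add: g_def)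
    then obtain j where j: "int s * int \<mu> - t * int Q = int g * j" by blast
    with t have "int g * \<bar>j\<bar> < int g * int h"
      by (simp add: h abs_mult)
    then have "\<bar>j\<bar> < int h" using \<open>g > 0\<close> by simp
    then have "j \<in> {- int h<..<int h}" by auto
    moreover have "\<mu> \<in> F j" using j \<open>\<mu> < Q\<close> by (auto simp: F_def)
    ultimately show "\<mu> \<in> (\<Union>j\<in>{- int h<..<int h}. F j)" by blast
  qed
  moreover have "finite (\<Union>j\<in>{- int h<..<int h}. F j)"
    by (simp add: F_def)
  ultimately have "card ?A \<le> card (\<Union>j\<in>{- int h<..<int h}. F j)"
    by (rule card_mono[rotated])
  also have "\<dots> \<le> (\<Sum>j\<in>{- int h<..<int h}. card (F j))"
    by (rule card_UN_le) simp
  also have "\<dots> \<le> (\<Sum>j\<in>{- int h<..<int h}. g)"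
    unfolding F_def g_def using assms(1) by (intro sum_mono card_linear_congruence_solutions_le)
  also have "\<dots> = (2 * h - 1) * g"
    using \<open>h > 0\<close> by (simp add: nat_diff_distrib nat_mult_distrib)
  also have "\<dots> < 2 * h * g"
    using \<open>h > 0\<close> \<open>g > 0\<close> by (intro mult_strict_right_mono) auto
  finally show ?thesis by (simp add: h mult_ac)
qed

lemma exists_multiplier_away_from_lattice:
  fixes S :: "nat set" and b m :: nat
  assumes "b > 0" and "finite S" and pos: "\<And>s. s \<in> S \<Longrightarrow> s > 0" and "2 * card S \<le> b ^ m"
  shows "\<exists>\<mu> k. \<forall>s\<in>S. \<forall>t. int (b ^ k) \<le> \<bar>int s * int \<mu> - t * int (b ^ (k + m))\<bar>"
proof -
  \<comment> \<open>Any common upper bound of \<open>S\<close> would do: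
    \<open>gcd s Q \<le> s \<le> k\<close> makes \<open>b ^ gcd s Q\<close>, and hence
    \<open>gcd s Q\<close> itself, divide \<open>b ^ k\<close>.\<close>
  define k where "k = \<Sum>S"
  define B Q where "B = b ^ k" and "Q = b ^ (k + m)"
  have "B > 0" "Q > 0" using assms(1) by (simp_all add: B_def Q_def)
  have QB: "Q = b ^ m * B" by (simp add: Q_def B_def power_add)
  define A where "A s = {\<mu>. \<mu> < Q \<and> (\<exists>t. \<bar>int s * int \<mu> - t * int Q\<bar> < int B)}" for s
  have less: "card (A s) < 2 * B" if "s \<in> S" for s
  proof -
    have "gcd s Q \<le> s" using pos[OF that] by (simp add: gcd_le1_nat)
    also have "s \<le> k"
      unfolding k_def using assms(2) that by (intro member_le_sum) auto
    finally have "b ^ gcd s Q dvd B" by (simp add: B_def le_imp_power_dvd)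
    moreover have "gcd s Q dvd b ^ gcd s Q"
      using assms(1) by (intro dvd_power_imp_dvd_power_self[of _ _ "k + m"]) (simp_all add: Q_def)
    ultimately have "gcd s Q dvd B" by (rule dvd_trans[rotated])
    with \<open>B > 0\<close> \<open>Q > 0\<close> show ?thesis
      unfolding A_def by (intro card_multiples_near_lattice_less)
  qed
  have "card (\<Union>s\<in>S. A s) < Q"
  \<comment> \<open>The strict inequality between the sums needs a nonempty
    \<open>S\<close>.\<close>
  proof (cases "S = {}")
    case False
    have "card (\<Union>s\<in>S. A s) \<le> (\<Sum>s\<in>S. card (A s))"
      using assms(2) by (rule card_UN_le)
    also have "\<dots> < (\<Sum>s\<in>S. 2 * B)"
      using assms(2) False less by (intro sum_strict_mono)
    also have "\<dots> = (2 * card S) * B" by simp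
    also have "\<dots> \<le> Q"
      unfolding QB using assms(4) by (rule mult_le_mono1)
    finally show ?thesis .
  qed (use \<open>Q > 0\<close> in simp)
  moreover have "finite (\<Union>s\<in>S. A s)"
    using assms(2) by (simp add: A_def)
  ultimately have "\<not> {..<Q} \<subseteq> (\<Union>s\<in>S. A s)"
    by (metis card_lessThan card_mono not_le)
  then obtain \<mu> where "\<mu> < Q" "\<And>s. s \<in> S \<Longrightarrow> \<mu> \<notin> A s" by blast
  then have "\<forall>s\<in>S. \<forall>t. int B \<le> \<bar>int s * int \<mu> - t * int Q\<bar>"
    by (auto simp: A_def not_less)
  then show ?thesis unfolding B_def Q_def by blast
qed

section \<open>Equal digit windows and distance to the lattice\<close>

lemma dig_eq_imp_mod_eq:
  assumes "b > 0" and "dig b x k m = dig b y k m"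
  shows "x div b ^ k mod b ^ m = y div b ^ k mod b ^ m"
proof -
  have expand: "z div b ^ k mod b ^ m = (\<Sum>i<m. digit b z (k + i) * b ^ i)" for z
  proof -
    have "digit b (z div b ^ k mod b ^ m) i = digit b z (k + i)" if "i < m" for i
    proof -
      \<comment> \<open>After division by \<open>b ^ i\<close> the remaining modulus is still a
        multiple of \<open>b\<close>, so truncation to \<open>m\<close> digits leaves digit
        \<open>i\<close> unchanged.\<close>
      have "b ^ m = b ^ i * (b * b ^ (m - Suc i))"
        using that by (simp flip: power_Suc power_add)
      then have "z div b ^ k mod b ^ m div b ^ i = z div b ^ k div b ^ i mod (b * b ^ (m - Suc i))"
        using assms(1) by (simp add: mod_mult2_eq)
      then show ?thesis
        by (simp add: digit_def div_mult2_eq power_add mod_mod_cancel)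
    qed
    then show ?thesis
      using digit_expansion[of "z div b ^ k mod b ^ m" b m] assms(1) by simp
  qed
  have "digit b x (k + i) = digit b y (k + i)" if "i < m" for i
    using assms(2) that by (auto simp: dig_def)
  then show ?thesis unfolding expand by simp
qed

lemma dig_mem_digit_tuples: "b \<ge> 2 \<Longrightarrow> dig b x k m \<in> digit_tuples b m"
  by (auto simp: dig_def digit_tuples_def digit_less)

text \<open>Each number splits into the part above the window, the window, and a remainder below
  \<open>b ^ k\<close>. The windows cancel, the difference of the upper parts serves as
  \<open>t\<close>, and two remainders differ by less than \<open>b ^ k\<close>.\<close>

lemma near_lattice_if_dig_eq:
  fixes x y :: nat
  assumes "b > 0" and "dig b x k m = dig b y k m"
  shows "\<exists>t. \<bar>int x - int y - t * int (b ^ (k + m))\<bar> < int (b ^ k)"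
proof -
  define B where "B = b ^ k"
  have "B > 0" using assms(1) by (simp add: B_def)
  have eq: "x div B mod b ^ m = y div B mod b ^ m"
    unfolding B_def using assms by (rule dig_eq_imp_mod_eq)
  have split: "int z = int (z div B div b ^ m) * int (b ^ (k + m))
      + int (z div B mod b ^ m) * int B + int (z mod B)" for z
  proof -
    have "z = z div B * B + z mod B" by simp
    also have "z div B = z div B div b ^ m * b ^ m + z div B mod b ^ m"
      by (rule div_mult_mod_eq[symmetric])
    finally have "z = (z div B div b ^ m * b ^ m + z div B mod b ^ m) * B + z mod B" .
    also have "\<dots> = z div B div b ^ m * b ^ (k + m) + z div B mod b ^ m * B + z mod B"
      by (simp only: B_def power_add distrib_right distrib_left mult_ac)
    finally show ?thesis by (metis of_nat_add of_nat_mult)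
  qed
  have "int x - int y - (int (x div B div b ^ m) - int (y div B div b ^ m)) * int (b ^ (k + m))
      = int (x mod B) - int (y mod B)"
    using split[of x] split[of y] eq by (simp only: left_diff_distrib)
  moreover have "int (x mod B) < int B" "int (y mod B) < int B"
    using \<open>B > 0\<close> by simp_all
  ultimately show ?thesis
    unfolding B_def[symmetric]
    by (intro exI[of _ "int (x div B div b ^ m) - int (y div B div b ^ m)"]) linarith
qed

section \<open>The set of differences\<close>

text \<open>The positive members, their negatives and \<open>0\<close> are disjoint parts of
  \<open>V\<close>.\<close>

lemma card_positive_part_symmetric:
  fixes V :: "int set"
  assumes "finite V" and "0 \<in> V" and sym: "\<And>v. v \<in> V \<Longrightarrow> - v \<in> V"
  shows "2 * card {s::nat. s > 0 \<and> int s \<in> V} + 1 \<le> card V"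
    and "finite {s::nat. s > 0 \<and> int s \<in> V}"
proof -
  let ?S = "{s::nat. s > 0 \<and> int s \<in> V}"
  have "finite (int -` V)"
    using assms(1) by (intro finite_vimageI) auto
  then show fin: "finite ?S" by (rule rev_finite_subset) auto
  let ?P = "int ` ?S" and ?N = "(\<lambda>s. - int s) ` ?S"
  have "card ?P = card ?S" "card ?N = card ?S"
    by (auto intro!: card_image inj_onI)
  moreover have "card (?P \<union> ?N) = card ?P + card ?N"
    using fin by (intro card_Un_disjoint) auto
  moreover have "card (insert 0 (?P \<union> ?N)) = Suc (card (?P \<union> ?N))"
    using fin by (intro card_insert_disjoint) auto
  moreover have "card (insert 0 (?P \<union> ?N)) \<le> card V"
    using assms by (intro card_mono) auto
  ultimately show "2 * card ?S + 1 \<le> card V" by simp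
qed

lemma sum_digits_less_power:
  fixes a :: "nat \<Rightarrow> nat"
  assumes "b > 0" and "\<And>j. j < l \<Longrightarrow> a j < b"
  shows "(\<Sum>j<l. a j * b ^ j) < b ^ l"
  using assms(2)
proof (induction l)
  case (Suc l)
  then have "(\<Sum>j<l. a j * b ^ j) < b ^ l" by simp
  moreover have "Suc (a l) * b ^ l \<le> b * b ^ l"
    using Suc.prems[of l] by (intro mult_le_mono1) simp
  ultimately show ?case by simp
qed simp

text \<open>The digits at the consecutive exponents of block \<open>i\<close> combine into a single
  number \<open>A i\<close> with \<open>l i\<close> digits, shifted by \<open>c i\<close>. Treating
  a block as one coefficient is what gives a factor \<open>2 * b ^ l i - 1\<close> instead of
  \<open>(2 * b - 1) ^ l i\<close>.\<close>

lemma ZD_block_decomposition: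
  fixes c l :: "'i \<Rightarrow> nat"
  assumes "b > 0" and "finite I" and inj: "inj_on d {..<n}"
    and D: "d ` {..<n} = (\<Union>i\<in>I. {c i..<c i + l i})"
    and disj: "disjoint_family_on (\<lambda>i. {c i..<c i + l i}) I"
    and "x \<in> ZD b n d"
  shows "\<exists>A. x = (\<Sum>i\<in>I. A i * b ^ c i) \<and> (\<forall>i\<in>I. A i < b ^ l i)"
proof -
  obtain a where x: "x = (\<Sum>i<n. a i * b ^ d i)" and a: "\<And>i. i < n \<Longrightarrow> a i < b"
    using assms(6) by (auto simp: ZD_def)
  \<comment> \<open>Digits are reindexed by their exponent \<open>d i\<close> instead of
    \<open>i\<close>.\<close>
  define e where "e = a \<circ> inv_into {..<n} d"
  have e_d: "e (d i) = a i" if "i < n" for i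
    using inj that by (simp add: e_def)
  have e: "e j < b" if "j \<in> d ` {..<n}" for j
    using that a e_d by auto
  define A where "A i = (\<Sum>j<l i. e (c i + j) * b ^ j)" for i
  have "x = (\<Sum>i<n. e (d i) * b ^ d i)"
    by (simp add: x e_d)
  also have "\<dots> = (\<Sum>j\<in>d ` {..<n}. e j * b ^ j)"
    using inj by (simp add: sum.reindex)
  also have "\<dots> = (\<Sum>i\<in>I. \<Sum>j\<in>{c i..<c i + l i}. e j * b ^ j)"
    unfolding D using assms(2) disj
    by (intro sum.UNION_disjoint) (auto simp: disjoint_family_on_def)
  also have "\<dots> = (\<Sum>i\<in>I. A i * b ^ c i)"
  proof (rule sum.cong[OF refl])
    fix i
    have "(\<Sum>j\<in>{c i..<c i + l i}. e j * b ^ j) = (\<Sum>j<l i. e (c i + j) * b ^ (c i + j))"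
      by (rule sum.reindex_bij_witness[of _ "\<lambda>j. c i + j" "\<lambda>j. j - c i"]) auto
    then show "(\<Sum>j\<in>{c i..<c i + l i}. e j * b ^ j) = A i * b ^ c i"
      by (simp add: A_def sum_distrib_right sum_distrib_left power_add mult_ac)
  qed
  finally have "x = (\<Sum>i\<in>I. A i * b ^ c i)" .
  moreover have "A i < b ^ l i" if "i \<in> I" for i
    unfolding A_def
  proof (rule sum_digits_less_power[OF assms(1)])
    fix j assume "j < l i"
    then have "c i + j \<in> d ` {..<n}"
      unfolding D using that by (intro UN_I[of i]) auto
    then show "e (c i + j) < b" by (rule e)
  qed
  ultimately show ?thesis by blast
qed

text \<open>The index type of the blocks is arbitrary so that both claims of the theorem become
  instances.\<close>

lemma exists_injective_digit_window:
  fixes c l :: "'i \<Rightarrow> nat"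
  assumes "b \<ge> 2" and "finite I" and inj: "inj_on d {..<n}"
    and D: "d ` {..<n} = (\<Union>i\<in>I. {c i..<c i + l i})"
    and disj: "disjoint_family_on (\<lambda>i. {c i..<c i + l i}) I"
    and m: "(\<Prod>i\<in>I. 2 * b ^ l i - 1) - 1 \<le> b ^ m"
  shows "\<exists>\<mu> k. inj_on (\<lambda>x. dig b (x * \<mu>) k m) (ZD b n d)"
proof -
  have "b > 0" using assms(1) by simp
  \<comment> \<open>Two block values below \<open>b ^ l i\<close> differ by one of
    \<open>2 * b ^ l i - 1\<close> integers; \<open>T\<close> collects these coefficient differences
    and \<open>V\<close> the integers they represent.\<close>
  define T where "T = (\<Pi>\<^sub>E i\<in>I. {- int (b ^ l i)<..<int (b ^ l i)})"
  define v where "v f = (\<Sum>i\<in>I. f i * int (b ^ c i))" for f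
  define V where "V = v ` T"
  have memV: "v f \<in> V" if "\<And>i. i \<in> I \<Longrightarrow> \<bar>f i\<bar> < int (b ^ l i)" for f
  proof -
    have "v f = v (restrict f I)" by (simp add: v_def)
    moreover have "restrict f I \<in> T"
      using that unfolding T_def restrict_PiE_iff by (auto simp: abs_less_iff minus_less_iff)
    ultimately show ?thesis by (simp add: V_def)
  qed
  have "finite T"
    unfolding T_def using assms(2) by (intro finite_PiE) auto
  then have "finite V" by (simp add: V_def)
  have "card T = (\<Prod>i\<in>I. 2 * b ^ l i - 1)"
    using assms(2) unfolding T_def card_PiE[OF assms(2)]
    by (intro prod.cong) (simp_all add: nat_diff_distrib' nat_mult_distrib nat_power_eq)
  \<comment> \<open>Only an inequality, since distinct tuples may represent the same
    integer.\<close>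
  then have cardV: "card V \<le> (\<Prod>i\<in>I. 2 * b ^ l i - 1)"
    using card_image_le[OF \<open>finite T\<close>, of v] by (simp add: V_def)
  have "0 \<in> V"
    using memV[of "\<lambda>_. 0"] \<open>b > 0\<close> by (simp add: v_def)
  have "- u \<in> V" if u: "u \<in> V" for u
  proof -
    obtain f where f: "f \<in> T" "u = v f" using u by (auto simp: V_def)
    have "v (\<lambda>i. - f i) \<in> V"
      using f(1) by (intro memV) (force simp: T_def abs_less_iff dest: PiE_mem)
    then show ?thesis by (simp add: f(2) v_def sum_negf)
  qed
  note positive = card_positive_part_symmetric[OF \<open>finite V\<close> \<open>0 \<in> V\<close> this]
  define S where "S = {s::nat. s > 0 \<and> int s \<in> V}"
  have "2 * card S \<le> b ^ m"
    using positive(1) cardV m unfolding S_def by linarith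
  then obtain \<mu> k where far:
      "\<And>s t. s \<in> S \<Longrightarrow> int (b ^ k) \<le> \<bar>int s * int \<mu> - t * int (b ^ (k + m))\<bar>"
    using exists_multiplier_away_from_lattice[of b S m] \<open>b > 0\<close> positive(2)
    unfolding S_def by blast
  \<comment> \<open>Equal windows would place \<open>(x - y) * \<mu>\<close> too close to the
    lattice, although \<open>x - y\<close> is a positive member of \<open>V\<close>.\<close>
  have neq: "dig b (x * \<mu>) k m \<noteq> dig b (y * \<mu>) k m"
    if xy: "x \<in> ZD b n d" "y \<in> ZD b n d" "y < x" for x y
  proof
    assume "dig b (x * \<mu>) k m = dig b (y * \<mu>) k m"
    then obtain t where "\<bar>int (x * \<mu>) - int (y * \<mu>) - t * int (b ^ (k + m))\<bar> < int (b ^ k)"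
      using near_lattice_if_dig_eq[OF \<open>b > 0\<close>] by blast
    moreover have "int (x * \<mu>) - int (y * \<mu>) = int (x - y) * int \<mu>"
      using xy(3) by (simp add: of_nat_diff left_diff_distrib)
    ultimately have "x - y \<notin> S" using far[of "x - y" t] by auto
    moreover have "int (x - y) \<in> V"
    proof -
      note decomp = ZD_block_decomposition[OF \<open>b > 0\<close> assms(2) inj D disj]
      obtain A A' where A: "x = (\<Sum>i\<in>I. A i * b ^ c i)" "\<And>i. i \<in> I \<Longrightarrow> A i < b ^ l i"
        and A': "y = (\<Sum>i\<in>I. A' i * b ^ c i)" "\<And>i. i \<in> I \<Longrightarrow> A' i < b ^ l i"
        using decomp[OF xy(1)] decomp[OF xy(2)] by metis
      have "v (\<lambda>i. int (A i) - int (A' i)) \<in> V"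
      proof (rule memV)
        fix i assume "i \<in> I"
        then show "\<bar>int (A i) - int (A' i)\<bar> < int (b ^ l i)"
          using A(2)[of i] A'(2)[of i] by linarith
      qed
      also have "v (\<lambda>i. int (A i) - int (A' i)) = int x - int y"
        by (simp add: v_def A(1) A'(1) left_diff_distrib sum_subtractf)
      finally show ?thesis using xy(3) by (simp add: of_nat_diff)
    qed
    ultimately show False using xy(3) by (simp add: S_def)
  qed
  have "inj_on (\<lambda>x. dig b (x * \<mu>) k m) (ZD b n d)"
    by (intro inj_onI) (metis neq linorder_neqE_nat)
  then show ?thesis by blast
qed

section \<open>Passing to the logarithmic form of \<open>m\<close>\<close>

text \<open>Rounding up and truncating at \<open>0\<close> can only enlarge the exponent; for
  \<open>N = 0\<close> the bound holds whatever value \<open>log\<close> takes there.\<close>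

lemma le_power_nat_ceiling_log:
  fixes b N :: nat
  assumes "b \<ge> 2"
  shows "N \<le> b ^ nat \<lceil>log (real b) (real N)\<rceil>"
proof (cases "N = 0")
  case False
  define m where "m = nat \<lceil>log (real b) (real N)\<rceil>"
  have "log (real b) (real N) \<le> real m"
    by (simp add: m_def real_nat_ceiling_ge)
  then have "real N \<le> real b powr real m"
    using assms False by (simp add: log_le_iff)
  also have "\<dots> = real (b ^ m)"
    using assms by (simp add: powr_realpow)
  finally show ?thesis unfolding m_def by (simp only: of_nat_le_iff)
qed simp

lemma exists_injective_digit_window_log:
  fixes c l :: "'i \<Rightarrow> nat"
  assumes "b \<ge> 2" and "finite I" and "inj_on d {..<n}"
    and "d ` {..<n} = (\<Union>i\<in>I. {c i..<c i + l i})"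
    and "disjoint_family_on (\<lambda>i. {c i..<c i + l i}) I"
    and m: "m = nat \<lceil>log (real b) ((\<Prod>i\<in>I. 2 * real b ^ l i - 1) - 1)\<rceil>"
  shows "\<exists>\<mu> k. (\<lambda>a. dig b (a * \<mu>) k m) \<in> ZD b n d \<rightarrow> digit_tuples b m \<and>
               inj_on (\<lambda>a. dig b (a * \<mu>) k m) (ZD b n d)"
proof -
  define P where "P = (\<Prod>i\<in>I. 2 * b ^ l i - 1)"
  \<comment> \<open>Subtraction on naturals truncates; this bound and \<open>P > 0\<close> make it
    agree with the real subtraction in the formula for \<open>m\<close>.\<close>
  have pos: "1 \<le> 2 * b ^ l i" for i
    using assms(1) by (simp add: Suc_leI)
  have "P > 0"
    unfolding P_def
  proof (rule prod_pos)
    fix i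
    have "b ^ l i > 0" using assms(1) by simp
    then show "0 < 2 * b ^ l i - 1" by linarith
  qed
  moreover have "real P = (\<Prod>i\<in>I. 2 * real b ^ l i - 1)"
    using pos by (simp add: P_def of_nat_diff)
  ultimately have "(\<Prod>i\<in>I. 2 * real b ^ l i - 1) - 1 = real (P - 1)"
    by (simp add: of_nat_diff)
  then have "P - 1 \<le> b ^ m"
    using le_power_nat_ceiling_log[OF assms(1), of "P - 1"] by (simp add: m)
  then show ?thesis
    using exists_injective_digit_window[OF assms(1-5)] dig_mem_digit_tuples[OF assms(1)]
    unfolding P_def by blast
qed

theorem theorem3:
  fixes b n :: nat and d :: "nat \<Rightarrow> nat" and D :: "nat set"
  assumes "b \<ge> 2" and "n \<ge> 1"
    and "D = d ` {..<n}" and "d 0 = 0" and "strict_mono_on {..<n} d"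
  shows "(\<forall>m. m = nat \<lceil>log (real b) ((2 * real b - 1) ^ n - 1)\<rceil> \<longrightarrow>
            (\<exists>\<mu> k :: nat. (\<lambda>a. dig b (a * \<mu>) k m) \<in> ZD b n d \<rightarrow> digit_tuples b m \<and>
               inj_on (\<lambda>a. dig b (a * \<mu>) k m) (ZD b n d)))
       \<and> (\<forall>(r :: nat) (c :: nat \<Rightarrow> nat) (l :: nat \<Rightarrow> nat) m.
            D = (\<Union>i\<in>{1..r}. {c i..<c i + l i}) \<and>
            disjoint_family_on (\<lambda>i. {c i..<c i + l i}) {1..r} \<and>
            (\<forall>i\<in>{1..r}. l i \<ge> 1) \<and>
            m = nat \<lceil>log (real b) ((\<Prod>i=1..r. 2 * real b ^ l i - 1) - 1)\<rceil> \<longrightarrow>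
            (\<exists>\<mu> k :: nat. (\<lambda>a. dig b (a * \<mu>) k m) \<in> ZD b n d \<rightarrow> digit_tuples b m \<and>
               inj_on (\<lambda>a. dig b (a * \<mu>) k m) (ZD b n d)))"
proof (intro conjI allI impI, goal_cases)
  case (1 m)
  have inj: "inj_on d {..<n}"
    using assms(5) by (rule strict_mono_on_imp_inj_on)
  \<comment> \<open>Singleton blocks \<open>{d i}\<close> turn the product into
    \<open>(2 * b - 1) ^ n\<close>.\<close>
  show ?case
  proof (rule exists_injective_digit_window_log[OF assms(1) finite_lessThan inj,
        where c = d and l = "\<lambda>_. 1"])
    show "disjoint_family_on (\<lambda>i. {d i..<d i + 1}) {..<n}"
      using inj by (auto simp: disjoint_family_on_def inj_on_def)
  qed (use 1 in auto)
next
  case (2 r c l m)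
  show ?case
    by (rule exists_injective_digit_window_log[OF assms(1) finite_atLeastAtMost
          strict_mono_on_imp_inj_on[OF assms(5)], where c = c and l = l])
      (use 2 assms(3) in auto)
qed

end
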